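(* Let $T$ be a tree, let $x_0$ be a vertex of $T$, and let $T_n\subseteq T$ be a model subtree with root vertex $x_0$ and branching function $n(r)$. Assume that $\underline{m}(r)=\min_{x\in S_r(x_0)}m(x)$, where $S_r(x_0)$ is the sphere in $T$ and $m(x)$ is the valence of $x$ in $T$, satisfies $$n(r)\le\underline{m}(r)-1\quad\text{for all } r>0.$$ If $T_n$ is stochastically incomplete, then so is $T$.
   Context: All graphs are infinite, locally finite and connected; $d(x,y)$ is the number of edges in a shortest path from $x$ to $y$, $m(x)$ is the valence (number of edges at $x$), $y\sim x$ means $x,y$ are joined by an edge, and $S_r(x_0)=\{x: d(x,x_0)=r\}$. A tree is called model if it contains a vertex $x_0$, the root, such that the valence is constant on each sphere about $x_0$: $m(x)=m(r)$ for all $x\in S_r(x_0)$. Its branching function is $n(r)=m(r)-1$ for $r>0$ and $n(0)=m(x_0)$ (valences in the model tree), and the tree is denoted $T_n$. The combinatorial Laplacian is $\Delta f(x)=\sum_{y\sim x}(f(x)-f(y))$. The heat kernel $p_t(x,y)$ of a graph with vertex set $V$ is the smallest non-negative function on $V\times V\times[0,\infty)$ which is smooth in $t$, satisfies $\Delta p+\frac{\partial p}{\partial t}=0$ (with $\Delta$ in either vertex variable) and $p_0(x,y)=\delta_x(y)$. The graph is stochastically incomplete if $\sum_{y\in V}p_{t_0}(x_0,y)<1$ for some vertex $x_0$ and some $t_0>0$, and stochastically complete otherwise. *)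

theory Defs
  imports "HOL-Analysis.Analysis"
begin

text \<open>
  The AFP entry Graph_Theory treats directed graphs, where a pair of opposite arcs already forms a
  cycle, so simple undirected graphs are set up here directly.
\<close>

record 'a ugraph =
  verts :: "'a set"
  adj :: "'a \<Rightarrow> 'a \<Rightarrow> bool"

definition simple_graph :: "'a ugraph \<Rightarrow> bool" where
  "simple_graph G \<longleftrightarrow>
     (\<forall>x y. adj G x y \<longrightarrow> x \<in> verts G \<and> y \<in> verts G \<and> x \<noteq> y \<and> adj G y x)"

definition neighbours :: "'a ugraph \<Rightarrow> 'a \<Rightarrow> 'a set" where
  "neighbours G x = {y. adj G x y}"

definition valence :: "'a ugraph \<Rightarrow> 'a \<Rightarrow> nat" where
  "valence G x = card (neighbours G x)"

definition locally_finite :: "'a ugraph \<Rightarrow> bool" where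
  "locally_finite G \<longleftrightarrow> (\<forall>x\<in>verts G. finite (neighbours G x))"

definition graph_connected :: "'a ugraph \<Rightarrow> bool" where
  "graph_connected G \<longleftrightarrow> (\<forall>x\<in>verts G. \<forall>y\<in>verts G. (adj G)\<^sup>*\<^sup>* x y)"

text \<open>The standing assumptions on all graphs.\<close>

definition admissible_graph :: "'a ugraph \<Rightarrow> bool" where
  "admissible_graph G \<longleftrightarrow>
     simple_graph G \<and> infinite (verts G) \<and> locally_finite G \<and> graph_connected G"

definition is_cycle :: "'a ugraph \<Rightarrow> 'a list \<Rightarrow> bool" where
  "is_cycle G xs \<longleftrightarrow>
     length xs \<ge> 3 \<and> distinct xs \<and> successively (adj G) xs \<and> adj G (last xs) (hd xs)"

definition is_tree :: "'a ugraph \<Rightarrow> bool" where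
  "is_tree G \<longleftrightarrow> admissible_graph G \<and> (\<nexists>xs. is_cycle G xs)"

definition subgraph :: "'a ugraph \<Rightarrow> 'a ugraph \<Rightarrow> bool" where
  "subgraph H G \<longleftrightarrow> verts H \<subseteq> verts G \<and> (\<forall>x y. adj H x y \<longrightarrow> adj G x y)"

text \<open>
  The relation \<open>adj G ^^ k\<close> holds between the endpoints of walks with \<open>k\<close> edges; a shortest walk is
  a path.  The value is meaningful for vertices joined by some walk, hence always in the connected
  graphs considered here.
\<close>

definition graph_dist :: "'a ugraph \<Rightarrow> 'a \<Rightarrow> 'a \<Rightarrow> nat" where
  "graph_dist G x y = (LEAST k. (adj G ^^ k) x y)"

definition graph_sphere :: "'a ugraph \<Rightarrow> 'a \<Rightarrow> nat \<Rightarrow> 'a set" where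
  "graph_sphere G x\<^sub>0 r = {x \<in> verts G. graph_dist G x x\<^sub>0 = r}"

definition min_valence :: "'a ugraph \<Rightarrow> 'a \<Rightarrow> nat \<Rightarrow> nat" where
  "min_valence G x\<^sub>0 r = Min (valence G ` graph_sphere G x\<^sub>0 r)"

definition model_tree :: "'a ugraph \<Rightarrow> 'a \<Rightarrow> bool" where
  "model_tree G x\<^sub>0 \<longleftrightarrow> is_tree G \<and> x\<^sub>0 \<in> verts G \<and>
     (\<exists>m. \<forall>r. \<forall>x\<in>graph_sphere G x\<^sub>0 r. valence G x = m r)"

text \<open>Integer arithmetic avoids the truncated subtraction of natural numbers.\<close>

definition branching_function :: "'a ugraph \<Rightarrow> 'a \<Rightarrow> (nat \<Rightarrow> nat) \<Rightarrow> bool" where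
  "branching_function G x\<^sub>0 n \<longleftrightarrow> n 0 = valence G x\<^sub>0 \<and>
     (\<forall>r>0. \<forall>x\<in>graph_sphere G x\<^sub>0 r. int (n r) = int (valence G x) - 1)"

definition laplacian :: "'a ugraph \<Rightarrow> ('a \<Rightarrow> real) \<Rightarrow> 'a \<Rightarrow> real" where
  "laplacian G f x = (\<Sum>y\<in>neighbours G x. f x - f y)"

text \<open>
  Smoothness on the half-line \<open>[0,\<infinity>)\<close>, one-sided at \<open>0\<close>: \<open>D k\<close> is the \<open>k\<close>-th derivative.
\<close>

definition smooth_half_line :: "(real \<Rightarrow> real) \<Rightarrow> bool" where
  "smooth_half_line f \<longleftrightarrow> (\<exists>D. (\<forall>t\<ge>0. D 0 t = f t) \<and>
     (\<forall>k::nat. \<forall>t\<ge>0. (D k has_real_derivative D (Suc k) t) (at t within {0..})))"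

text \<open>
  Functions on \<open>V \<times> V \<times> [0,\<infinity>)\<close> are represented by total functions whose values outside that domain
  are ignored.  The heat equation is required in each of the two vertex variables.
\<close>

definition heat_solution :: "'a ugraph \<Rightarrow> ('a \<Rightarrow> 'a \<Rightarrow> real \<Rightarrow> real) \<Rightarrow> bool" where
  "heat_solution G p \<longleftrightarrow> (\<forall>x\<in>verts G. \<forall>y\<in>verts G.
     smooth_half_line (p x y) \<and>
     p x y 0 = (if x = y then 1 else 0) \<and>
     (\<forall>t\<ge>0. p x y t \<ge> 0 \<and>
        (p x y has_real_derivative - laplacian G (\<lambda>z. p z y t) x) (at t within {0..}) \<and>
        (p x y has_real_derivative - laplacian G (\<lambda>z. p x z t) y) (at t within {0..})))"

definition is_heat_kernel :: "'a ugraph \<Rightarrow> ('a \<Rightarrow> 'a \<Rightarrow> real \<Rightarrow> real) \<Rightarrow> bool" where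
  "is_heat_kernel G p \<longleftrightarrow> heat_solution G p \<and>
     (\<forall>q. heat_solution G q \<longrightarrow> (\<forall>x\<in>verts G. \<forall>y\<in>verts G. \<forall>t\<ge>0. p x y t \<le> q x y t))"

text \<open>
  The heat kernel is determined on \<open>V \<times> V \<times> [0,\<infinity>)\<close> by minimality.  The sum is taken in the extended
  non-negative reals, since \<^const>\<open>infsum\<close> over the reals is \<open>0\<close> for divergent sums.
\<close>

definition stochastically_incomplete :: "'a ugraph \<Rightarrow> bool" where
  "stochastically_incomplete G \<longleftrightarrow> (\<exists>p. is_heat_kernel G p \<and>
     (\<exists>x\<^sub>0\<in>verts G. \<exists>t\<^sub>0>0. (\<Sum>\<^sub>\<infinity>y\<in>verts G. ennreal (p x\<^sub>0 y t\<^sub>0)) < 1))"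

end

theory Submission
  imports Defs
begin

text \<open>
  Let \<open>v\<close> be the radial solution of \<open>\<Delta>v + v = 0\<close> on \<open>T\<^sub>n\<close> with \<open>v(x\<^sub>0) = 1\<close>; it increases with the
  distance from the root.  If \<open>v\<close> were unbounded, the minimum principle would show that \<open>T\<^sub>n\<close> conserves
  heat, so \<open>v\<close> is bounded.  Transplanted to \<open>T\<close> along the distance from \<open>x\<^sub>0\<close>, it satisfies
  \<open>\<Delta>v + v \<le> 0\<close>, because every vertex of \<open>T\<close> has a single neighbour closer to the root and at least
  \<open>n(r)\<close> neighbours farther away.  A bounded positive subsolution yields a supersolution of the heat
  equation that drops below its initial lower bound \<open>1\<close> and dominates the total heat.
\<close>

section \<open>Linear differential inequalities on the half-line\<close>

lemma at_within_Ici_Icc: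
  fixes t b :: real
  assumes "t < b"
  shows "at t within {0..} = at t within {0..b}"
  by (rule at_within_nhd[of _ "{..<b}"]) (use assms in auto)

text \<open>Integrating factor: exp (c s) f(s) has non-negative derivative, so it never falls below
  f(0). The hypotheses stop at \<open>b\<close> because the supersolution built later is
  non-negative only up to a finite time.\<close>

lemma nonneg_of_linear_differential_inequality:
  fixes f f' :: "real \<Rightarrow> real" and c b :: real
  assumes deriv: "\<And>t. 0 \<le> t \<Longrightarrow> t \<le> b \<Longrightarrow> (f has_real_derivative f' t) (at t within {0..})"
    and ineq: "\<And>t. 0 \<le> t \<Longrightarrow> t \<le> b \<Longrightarrow> 0 \<le> f' t + c * f t"
    and init: "0 \<le> f 0" and t: "0 \<le> t" "t \<le> b"
  shows "0 \<le> f t"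
proof (cases "t = 0")
  case True
  then show ?thesis using init by simp
next
  case False
  then have t0: "0 < t" using t by simp
  let ?F = "\<lambda>s. exp (c * s) * f s"
  have D: "(?F has_real_derivative exp (c * s) * (f' s + c * f s)) (at s within {0..})"
    if "0 \<le> s" "s \<le> b" for s
    by (auto intro!: derivative_eq_intros deriv that simp: algebra_simps)
  have "?F 0 \<le> ?F t"
  proof (rule DERIV_nonneg_imp_increasing_open[where f = ?F])
    show "\<exists>y. (?F has_real_derivative y) (at s) \<and> 0 \<le> y" if "0 < s" "s < t" for s
    proof -
      have "at s within {0..} = at s"
        using that by (intro at_within_interior) auto
      then have "(?F has_real_derivative exp (c * s) * (f' s + c * f s)) (at s)"
        using D[of s] that t by simp
      then show ?thesis using ineq[of s] that t
        by (intro exI[of _ "exp (c * s) * (f' s + c * f s)"] conjI) auto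
    qed
    show "continuous_on {0..t} ?F"
    proof (rule DERIV_continuous_on)
      show "(?F has_real_derivative exp (c * s) * (f' s + c * f s)) (at s within {0..t})"
        if "s \<in> {0..t}" for s
        by (rule has_field_derivative_subset[OF D]) (use that t in auto)
    qed
  qed (rule t)
  then have "0 \<le> exp (c * t) * f t" using init by simp
  then show ?thesis by (simp add: zero_le_mult_iff)
qed

text \<open>Variation of constants: this \<open>f\<close> solves f' + c f = g with f(0) = d.\<close>

lemma has_real_derivative_duhamel:
  fixes g :: "real \<Rightarrow> real" and c d t :: real
  assumes "continuous_on {0..} g" "0 \<le> t"
  defines "f \<equiv> \<lambda>t. exp (- c * t) * (d + integral {0..t} (\<lambda>s. exp (c * s) * g s))"
  shows "(f has_real_derivative g t - c * f t) (at t within {0..})"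
proof -
  let ?I = "\<lambda>t. integral {0..t} (\<lambda>s. exp (c * s) * g s)"
  have "(?I has_real_derivative exp (c * t) * g t) (at t within {0..t + 1})"
    by (rule integral_has_real_derivative)
      (use assms in \<open>auto intro!: continuous_intros intro: continuous_on_subset\<close>)
  then have I: "(?I has_real_derivative exp (c * t) * g t) (at t within {0..})"
    using at_within_Ici_Icc[of t "t + 1"] by simp
  have "(f has_real_derivative - c * exp (- c * t) * (d + ?I t)
      + exp (- c * t) * (exp (c * t) * g t)) (at t within {0..})"
    unfolding f_def by (rule derivative_eq_intros I refl | simp)+
  moreover have "- c * exp (- c * t) * (d + ?I t) + exp (- c * t) * (exp (c * t) * g t)
      = g t - c * f t"
    by (simp add: f_def exp_minus)
  ultimately show ?thesis by simp
qed

text \<open>Pass to the limit in the integrated equation by dominated convergence, the constant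
  \<open>C\<close> dominating, then differentiate f(s) = f(0) + integral of g, which continuity of g
  permits. Pointwise convergence of the derivatives thus suffices.\<close>

lemma has_real_derivative_limit:
  fixes F G :: "nat \<Rightarrow> real \<Rightarrow> real" and f g :: "real \<Rightarrow> real" and C :: real
  assumes deriv: "\<And>N t. 0 \<le> t \<Longrightarrow> (F N has_real_derivative G N t) (at t within {0..})"
    and bound: "\<And>N t. 0 \<le> t \<Longrightarrow> \<bar>G N t\<bar> \<le> C"
    and F: "\<And>t. 0 \<le> t \<Longrightarrow> (\<lambda>N. F N t) \<longlonglongrightarrow> f t"
    and G: "\<And>t. 0 \<le> t \<Longrightarrow> (\<lambda>N. G N t) \<longlonglongrightarrow> g t"
    and cont: "continuous_on {0..} g" and t: "0 \<le> t"
  shows "(f has_real_derivative g t) (at t within {0..})"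
proof -
  have FTC: "(G N has_integral F N s - F N 0) {0..s}" if "0 \<le> s" for N s
    by (rule fundamental_theorem_of_calculus)
      (use that in \<open>auto simp flip: has_real_derivative_iff_has_vector_derivative
        intro!: has_field_derivative_subset[OF deriv]\<close>)
  have f: "f s = f 0 + integral {0..s} g" if s: "0 \<le> s" for s
  proof -
    have "(\<lambda>N. integral {0..s} (G N)) \<longlonglongrightarrow> integral {0..s} g"
    proof (rule dominated_convergence(2))
      show "G N integrable_on {0..s}" for N using FTC[OF s] by blast
      show "(\<lambda>_. C) integrable_on {0..s}"
        by (intro integrable_continuous_real continuous_on_const)
      show "norm (G N u) \<le> C" if "u \<in> {0..s}" for N u using bound that by simp
      show "(\<lambda>N. G N u) \<longlonglongrightarrow> g u" if "u \<in> {0..s}" for u using G that by simp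
    qed
    moreover have "integral {0..s} (G N) = F N s - F N 0" for N
      using FTC[OF s] by blast
    moreover have "(\<lambda>N. F N s - F N 0) \<longlonglongrightarrow> f s - f 0"
      by (intro tendsto_diff F) (use s in auto)
    ultimately have "integral {0..s} g = f s - f 0"
      using LIMSEQ_unique by fastforce
    then show ?thesis by simp
  qed
  have "((\<lambda>s. integral {0..s} g) has_real_derivative g t) (at t within {0..t + 1})"
    by (rule integral_has_real_derivative)
      (use t cont in \<open>auto intro: continuous_on_subset\<close>)
  then have "((\<lambda>s. f 0 + integral {0..s} g) has_real_derivative g t) (at t within {0..})"
    using at_within_Ici_Icc[of t "t + 1"] by (auto intro!: derivative_eq_intros)
  then show ?thesis
    by (rule has_field_derivative_transform_within[where d = 1])
      (use t in \<open>auto intro: f[symmetric]\<close>)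
qed

section \<open>Construction of the heat kernel\<close>

text \<open>
  Picard iterates of the backward equation \<open>\<partial>p/\<partial>t + m(x) p = \<Sum>\<^bsub>z \<sim> x\<^esub> p(z, y)\<close>: the \<open>N\<close>-th one
  counts the trajectories with fewer than \<open>N\<close> jumps.
\<close>

primrec heat_approx :: "'a ugraph \<Rightarrow> nat \<Rightarrow> 'a \<Rightarrow> 'a \<Rightarrow> real \<Rightarrow> real" where
  "heat_approx G 0 = (\<lambda>x y t. 0)"
| "heat_approx G (Suc N) = (\<lambda>x y t. exp (- real (valence G x) * t) *
     ((if x = y then 1 else 0) + integral {0..t}
        (\<lambda>s. exp (real (valence G x) * s) * (\<Sum>z\<in>neighbours G x. heat_approx G N z y s))))"

text \<open>For t >= 0 and finite neighbourhoods the iterates increase and stay below or at 1, so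
  this supremum is their limit.\<close>

definition min_heat_kernel :: "'a ugraph \<Rightarrow> 'a \<Rightarrow> 'a \<Rightarrow> real \<Rightarrow> real" where
  "min_heat_kernel G x y t = (SUP N. heat_approx G N x y t)"

lemma laplacian_eq:
  assumes "finite (neighbours G x)"
  shows "laplacian G f x = real (valence G x) * f x - (\<Sum>y\<in>neighbours G x. f y)"
  by (simp add: laplacian_def valence_def sum_subtractf)

lemma heat_approx_zero: "heat_approx G (Suc N) x y 0 = (if x = y then 1 else 0)"
  by simp

lemma heat_approx_continuous: "continuous_on {0..} (heat_approx G N x y)"
proof (induction N arbitrary: x)
  case (Suc N)
  have "continuous_on {0..} (\<lambda>s. \<Sum>z\<in>neighbours G x. heat_approx G N z y s)"
    by (intro continuous_on_sum Suc)
  then show ?case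
    unfolding heat_approx.simps
    by (intro DERIV_continuous_on[OF has_real_derivative_duhamel]) auto
qed simp

lemma heat_approx_deriv:
  assumes "0 \<le> t"
  shows "(heat_approx G (Suc N) x y has_real_derivative
    (\<Sum>z\<in>neighbours G x. heat_approx G N z y t)
      - real (valence G x) * heat_approx G (Suc N) x y t) (at t within {0..})"
proof -
  have "continuous_on {0..} (\<lambda>s. \<Sum>z\<in>neighbours G x. heat_approx G N z y s)"
    by (intro continuous_on_sum heat_approx_continuous)
  from has_real_derivative_duhamel[OF this assms, of "real (valence G x)"] show ?thesis
    by simp
qed

declare heat_approx.simps(2) [simp del]

section \<open>Positivity, monotonicity and comparison of the iterates\<close>

lemma heat_approx_nonneg: "0 \<le> t \<Longrightarrow> 0 \<le> heat_approx G N x y t"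
proof (induction N arbitrary: x t)
  case (Suc N)
  show ?case
    by (rule nonneg_of_linear_differential_inequality
        [OF heat_approx_deriv, where b = t and c = "real (valence G x)"])
      (use Suc in \<open>auto intro: sum_nonneg simp: heat_approx_zero\<close>)
qed simp

text \<open>From the first iterate on the initial values agree, and the difference of consecutive
  iterates solves a linear equation whose source, the difference one level lower, is non-negative by
  induction.\<close>

lemma heat_approx_mono_Suc: "0 \<le> t \<Longrightarrow> heat_approx G N x y t \<le> heat_approx G (Suc N) x y t"
proof (induction N arbitrary: x t)
  case 0
  then show ?case using heat_approx_nonneg[of t G "Suc 0"] by simp
next
  case (Suc N)
  have "0 \<le> heat_approx G (Suc (Suc N)) x y t - heat_approx G (Suc N) x y t"
    by (rule nonneg_of_linear_differential_inequality
        [OF DERIV_diff[OF heat_approx_deriv heat_approx_deriv],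
          where b = t and c = "real (valence G x)"])
      (use Suc in \<open>auto intro: sum_mono simp: heat_approx_zero algebra_simps\<close>)
  then show ?case by simp
qed

lemma heat_approx_incseq: "0 \<le> t \<Longrightarrow> incseq (\<lambda>N. heat_approx G N x y t)"
  by (intro incseq_SucI heat_approx_mono_Suc)

text \<open>The comparison runs vertex by vertex: the gap f between \<open>S\<close> and the sum
  satisfies f' + m(x) f >= 0, because the induction hypothesis bounds the inflow from the
  neighbours. A general finite \<open>F\<close> serves to control the total heat, a singleton
  \<open>F\<close> a single entry.\<close>

lemma sum_heat_approx_le_supersolution:
  fixes S S' :: "'a \<Rightarrow> real \<Rightarrow> real"
  assumes fin: "\<And>x. x \<in> V \<Longrightarrow> finite (neighbours G x)"
    and closed: "\<And>x. x \<in> V \<Longrightarrow> neighbours G x \<subseteq> V"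
    and deriv: "\<And>x t. x \<in> V \<Longrightarrow> 0 \<le> t \<Longrightarrow> t \<le> b
      \<Longrightarrow> (S x has_real_derivative S' x t) (at t within {0..})"
    and super: "\<And>x t. x \<in> V \<Longrightarrow> 0 \<le> t \<Longrightarrow> t \<le> b \<Longrightarrow> - laplacian G (\<lambda>z. S z t) x \<le> S' x t"
    and nonneg: "\<And>x t. x \<in> V \<Longrightarrow> 0 \<le> t \<Longrightarrow> t \<le> b \<Longrightarrow> 0 \<le> S x t"
    and init: "\<And>x. x \<in> V \<Longrightarrow> (if x \<in> F then 1 else 0) \<le> S x 0"
    and F: "finite F"
  shows "x \<in> V \<Longrightarrow> 0 \<le> t \<Longrightarrow> t \<le> b \<Longrightarrow> (\<Sum>y\<in>F. heat_approx G N x y t) \<le> S x t"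
proof (induction N arbitrary: x t)
  case 0
  then show ?case using nonneg by simp
next
  case (Suc N)
  let ?m = "real (valence G x)"
  have D: "((\<lambda>t. S x t - (\<Sum>y\<in>F. heat_approx G (Suc N) x y t)) has_real_derivative
      S' x t - (\<Sum>y\<in>F. (\<Sum>z\<in>neighbours G x. heat_approx G N z y t)
        - ?m * heat_approx G (Suc N) x y t)) (at t within {0..})" if "0 \<le> t" "t \<le> b" for t
    by (intro DERIV_diff deriv DERIV_sum heat_approx_deriv Suc.prems(1) that)
  have "0 \<le> S x t - (\<Sum>y\<in>F. heat_approx G (Suc N) x y t)"
  proof (rule nonneg_of_linear_differential_inequality[OF D, where c = ?m])
    fix s assume s: "0 \<le> s" "s \<le> b"
    have "(\<Sum>y\<in>F. \<Sum>z\<in>neighbours G x. heat_approx G N z y s)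
        = (\<Sum>z\<in>neighbours G x. \<Sum>y\<in>F. heat_approx G N z y s)"
      by (rule sum.swap)
    also have "\<dots> \<le> (\<Sum>z\<in>neighbours G x. S z s)"
      using Suc closed s by (intro sum_mono) blast
    also have "\<dots> \<le> S' x s + ?m * S x s"
      using super[of x s] Suc.prems s fin[of x] by (simp add: laplacian_eq)
    finally show "0 \<le> S' x s - (\<Sum>y\<in>F. (\<Sum>z\<in>neighbours G x. heat_approx G N z y s)
        - ?m * heat_approx G (Suc N) x y s)
        + ?m * (S x s - (\<Sum>y\<in>F. heat_approx G (Suc N) x y s))"
      by (simp add: sum_subtractf sum_distrib_left algebra_simps)
  next
    show "0 \<le> S x 0 - (\<Sum>y\<in>F. heat_approx G (Suc N) x y 0)"
      using init[of x] Suc.prems(1) F by (simp add: heat_approx_zero)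
  qed (use Suc.prems in auto)
  then show ?case by simp
qed

text \<open>The constant 1 is a supersolution that dominates the initial value.\<close>

lemma heat_approx_le_one:
  assumes fin: "\<And>x. finite (neighbours G x)" and "0 \<le> t"
  shows "heat_approx G N x y t \<le> 1"
proof -
  have "(\<Sum>y\<in>{y}. heat_approx G N x y t) \<le> 1"
    by (rule sum_heat_approx_le_supersolution[where V = UNIV and S' = "\<lambda>_ _. 0" and b = t])
      (use assms in \<open>auto simp: laplacian_def\<close>)
  then show ?thesis by simp
qed

text \<open>
  The defect of the forward equation satisfies the homogeneous equation in the first variable with
  zero initial value.
\<close>

lemma heat_approx_forward:
  assumes fin: "\<And>x. finite (neighbours G x)"
    and sym: "\<And>x y. adj G x y \<longleftrightarrow> adj G y x"
  shows "0 \<le> t \<Longrightarrow> (\<Sum>z\<in>neighbours G x. heat_approx G N z y t)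
      - real (valence G x) * heat_approx G (Suc N) x y t
    = (\<Sum>z\<in>neighbours G y. heat_approx G N x z t)
      - real (valence G y) * heat_approx G (Suc N) x y t"
proof (induction N arbitrary: x y t)
  case 0
  then show ?case
    by (cases "x = y") (simp_all add: heat_approx.simps(2))
next
  case (Suc N)
  let ?m = "\<lambda>x. real (valence G x)"
  let ?A = "\<lambda>x y t. \<Sum>z\<in>neighbours G x. heat_approx G N z y t"
  let ?p = "heat_approx G (Suc N)" and ?q = "heat_approx G (Suc (Suc N))"
  \<comment> \<open>\<open>g\<close> is the defect, and \<open>g'\<close> is its derivative as
    computed from the backward equation.\<close>
  define g where "g = (\<lambda>t. (\<Sum>z\<in>neighbours G x. ?p z y t) - ?m x * ?q x y t
    - ((\<Sum>z\<in>neighbours G y. ?p x z t) - ?m y * ?q x y t))"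
  define g' where "g' = (\<lambda>t. (\<Sum>z\<in>neighbours G x. ?A z y t - ?m z * ?p z y t)
    - ?m x * ((\<Sum>z\<in>neighbours G x. ?p z y t) - ?m x * ?q x y t)
    - ((\<Sum>z\<in>neighbours G y. ?A x z t - ?m x * ?p x z t)
      - ?m y * ((\<Sum>z\<in>neighbours G x. ?p z y t) - ?m x * ?q x y t)))"
  have D: "(g has_real_derivative g' t) (at t within {0..})" if "0 \<le> t" for t
    unfolding g_def g'_def
    by (intro DERIV_diff DERIV_sum DERIV_cmult heat_approx_deriv that)
  \<comment> \<open>The induction hypothesis and an exchange of the two neighbour sums make the
    double sums cancel; m(x) factors out of the rest.\<close>
  have eq: "g' t = - ?m x * g t" if "0 \<le> t" for t
  proof -
    have "(\<Sum>z\<in>neighbours G x. ?A z y t - ?m z * ?p z y t)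
        = (\<Sum>z\<in>neighbours G x. (\<Sum>w\<in>neighbours G y. heat_approx G N z w t) - ?m y * ?p z y t)"
      by (intro sum.cong refl Suc.IH that)
    also have "\<dots> = (\<Sum>z\<in>neighbours G x. \<Sum>w\<in>neighbours G y. heat_approx G N z w t)
        - ?m y * (\<Sum>z\<in>neighbours G x. ?p z y t)"
      by (simp add: sum_subtractf sum_distrib_left)
    also have "(\<Sum>z\<in>neighbours G x. \<Sum>w\<in>neighbours G y. heat_approx G N z w t)
        = (\<Sum>w\<in>neighbours G y. ?A x w t)"
      by (rule sum.swap)
    finally have 1: "(\<Sum>z\<in>neighbours G x. ?A z y t - ?m z * ?p z y t)
        = (\<Sum>w\<in>neighbours G y. ?A x w t) - ?m y * (\<Sum>z\<in>neighbours G x. ?p z y t)" .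
    have 2: "(\<Sum>z\<in>neighbours G y. ?A x z t - ?m x * ?p x z t)
        = (\<Sum>z\<in>neighbours G y. ?A x z t) - ?m x * (\<Sum>z\<in>neighbours G y. ?p x z t)"
      by (simp add: sum_subtractf sum_distrib_left)
    show ?thesis unfolding g_def g'_def 1 2 by (simp add: algebra_simps)
  qed
  have "y \<in> neighbours G x \<longleftrightarrow> x \<in> neighbours G y"
    using sym by (simp add: neighbours_def)
  then have init: "g 0 = 0"
    using fin by (cases "x = y") (simp_all add: g_def heat_approx_zero)
  \<comment> \<open>Both \<open>g\<close> and \<open>- g\<close> satisfy the linear inequality and
    start at 0, so the defect vanishes.\<close>
  have "0 \<le> g t"
    by (rule nonneg_of_linear_differential_inequality[OF D, where b = t and c = "?m x"])
      (use Suc.prems eq init in auto)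
  moreover have "0 \<le> - g t"
    by (rule nonneg_of_linear_differential_inequality[OF DERIV_minus[OF D], where b = t and c = "?m x"])
      (use Suc.prems eq init in auto)
  ultimately show ?case by (simp add: g_def)
qed

section \<open>Passage to the limit\<close>

context
  fixes G :: "'a ugraph"
  assumes fin: "\<And>x. finite (neighbours G x)"
begin

lemma heat_approx_tendsto:
  assumes "0 \<le> t"
  shows "(\<lambda>N. heat_approx G N x y t) \<longlonglongrightarrow> min_heat_kernel G x y t"
  unfolding min_heat_kernel_def
  by (rule LIMSEQ_incseq_SUP)
    (auto intro!: bdd_aboveI2[where M = 1] heat_approx_le_one fin heat_approx_incseq assms)

text \<open>The derivative of an iterate is inflow minus outflow, each between 0 and m(x). Hence 2
  m(x) is a common Lipschitz constant, which the pointwise limit inherits. Continuity is what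
  \<open>has_real_derivative_limit\<close> asks of the limiting derivative.\<close>

lemma min_heat_kernel_continuous: "continuous_on {0..} (min_heat_kernel G x y)"
proof -
  define m where "m = real (valence G x)"
  have lip: "\<bar>heat_approx G (Suc N) x y s - heat_approx G (Suc N) x y t\<bar> \<le> 2 * m * \<bar>s - t\<bar>"
    if "0 \<le> s" "0 \<le> t" for N s t
  proof -
    have "norm (heat_approx G (Suc N) x y s - heat_approx G (Suc N) x y t)
        \<le> 2 * m * norm (s - t)"
    proof (rule field_differentiable_bound[OF convex_real_interval(1)[of 0] heat_approx_deriv])
      fix u :: real assume "u \<in> {0..}"
      then have u: "0 \<le> u" by simp
      have "(\<Sum>z\<in>neighbours G x. heat_approx G N z y u) \<le> (\<Sum>z\<in>neighbours G x. 1)"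
        by (intro sum_mono heat_approx_le_one fin u)
      then have "(\<Sum>z\<in>neighbours G x. heat_approx G N z y u) \<le> m"
        by (simp add: m_def valence_def)
      moreover have "0 \<le> (\<Sum>z\<in>neighbours G x. heat_approx G N z y u)"
        by (intro sum_nonneg heat_approx_nonneg u)
      moreover have "0 \<le> m * heat_approx G (Suc N) x y u"
        by (intro mult_nonneg_nonneg heat_approx_nonneg u) (simp add: m_def)
      moreover have "m * heat_approx G (Suc N) x y u \<le> m * 1"
        by (intro mult_left_mono heat_approx_le_one fin u) (simp add: m_def)
      ultimately show "norm ((\<Sum>z\<in>neighbours G x. heat_approx G N z y u)
          - real (valence G x) * heat_approx G (Suc N) x y u) \<le> 2 * m"
        unfolding m_def by simp
    qed (use that in auto)
    then show ?thesis by simp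
  qed
  have "(2 * m)-lipschitz_on {0..} (min_heat_kernel G x y)"
  proof (rule lipschitz_onI)
    fix s t :: real assume st: "s \<in> {0..}" "t \<in> {0..}"
    have lim: "(\<lambda>N. heat_approx G (Suc N) x y u) \<longlonglongrightarrow> min_heat_kernel G x y u"
      if "0 \<le> u" for u
      by (rule LIMSEQ_Suc[OF heat_approx_tendsto[OF that]])
    have "(\<lambda>N. \<bar>heat_approx G (Suc N) x y s - heat_approx G (Suc N) x y t\<bar>)
        \<longlonglongrightarrow> \<bar>min_heat_kernel G x y s - min_heat_kernel G x y t\<bar>"
      by (intro tendsto_rabs tendsto_diff lim) (use st in auto)
    then have "\<bar>min_heat_kernel G x y s - min_heat_kernel G x y t\<bar> \<le> 2 * m * \<bar>s - t\<bar>"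
      by (rule LIMSEQ_le_const2) (use lip st in auto)
    then show "dist (min_heat_kernel G x y s) (min_heat_kernel G x y t) \<le> 2 * m * dist s t"
      by (simp add: dist_real_def)
  qed (simp add: m_def)
  then show ?thesis by (rule lipschitz_on_continuous_on)
qed

lemma min_heat_kernel_nonneg: "0 \<le> t \<Longrightarrow> 0 \<le> min_heat_kernel G x y t"
  by (rule LIMSEQ_le_const[OF heat_approx_tendsto]) (auto intro: heat_approx_nonneg)

lemma min_heat_kernel_zero: "min_heat_kernel G x y 0 = (if x = y then 1 else 0)"
proof -
  have "(\<lambda>N. heat_approx G (Suc N) x y 0) \<longlonglongrightarrow> min_heat_kernel G x y 0"
    by (rule LIMSEQ_Suc[OF heat_approx_tendsto]) simp
  then show ?thesis
    using LIMSEQ_unique unfolding heat_approx_zero by blast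
qed

text \<open>The index maps \<open>a\<close> and \<open>b\<close> let one limit argument serve both
  variables: the neighbour sum may run over the first or the second argument of the kernel.\<close>

lemma min_heat_kernel_limit_deriv:
  assumes deriv: "\<And>N t. 0 \<le> t \<Longrightarrow> (heat_approx G (Suc N) x y has_real_derivative
      (\<Sum>i\<in>I. heat_approx G N (a i) (b i) t) - c * heat_approx G (Suc N) x y t)
      (at t within {0..})"
    and "0 \<le> t" "finite I"
  shows "(min_heat_kernel G x y has_real_derivative
      (\<Sum>i\<in>I. min_heat_kernel G (a i) (b i) t) - c * min_heat_kernel G x y t) (at t within {0..})"
proof (rule has_real_derivative_limit[OF deriv, where C = "real (card I) + \<bar>c\<bar>"])
  fix N :: nat and t :: real assume t: "0 \<le> t"
  have "(\<Sum>i\<in>I. heat_approx G N (a i) (b i) t) \<le> (\<Sum>i\<in>I. 1)"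
    by (intro sum_mono heat_approx_le_one fin t)
  moreover have "0 \<le> (\<Sum>i\<in>I. heat_approx G N (a i) (b i) t)"
    by (intro sum_nonneg heat_approx_nonneg t)
  moreover have "\<bar>c * heat_approx G (Suc N) x y t\<bar> \<le> \<bar>c\<bar> * 1"
    unfolding abs_mult
    using heat_approx_le_one[OF fin t, of "Suc N" x y] heat_approx_nonneg[OF t, of G "Suc N" x y]
    by (intro mult_left_mono) auto
  ultimately show "\<bar>(\<Sum>i\<in>I. heat_approx G N (a i) (b i) t) - c * heat_approx G (Suc N) x y t\<bar>
      \<le> real (card I) + \<bar>c\<bar>"
    by simp
next
  fix t :: real assume t: "0 \<le> t"
  show lim: "(\<lambda>N. heat_approx G (Suc N) x y t) \<longlonglongrightarrow> min_heat_kernel G x y t"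
    by (rule LIMSEQ_Suc[OF heat_approx_tendsto[OF t]])
  show "(\<lambda>N. (\<Sum>i\<in>I. heat_approx G N (a i) (b i) t) - c * heat_approx G (Suc N) x y t)
      \<longlonglongrightarrow> (\<Sum>i\<in>I. min_heat_kernel G (a i) (b i) t) - c * min_heat_kernel G x y t"
    by (intro tendsto_intros lim heat_approx_tendsto t)
qed (use assms in \<open>auto intro!: continuous_intros min_heat_kernel_continuous\<close>)

lemma min_heat_kernel_backward:
  assumes "0 \<le> t"
  shows "(min_heat_kernel G x y has_real_derivative
    - laplacian G (\<lambda>z. min_heat_kernel G z y t) x) (at t within {0..})"
  using min_heat_kernel_limit_deriv[OF heat_approx_deriv assms fin]
  by (simp add: laplacian_eq fin)

lemma min_heat_kernel_forward:
  assumes sym: "\<And>x y. adj G x y \<longleftrightarrow> adj G y x" and "0 \<le> t"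
  shows "(min_heat_kernel G x y has_real_derivative
    - laplacian G (\<lambda>z. min_heat_kernel G x z t) y) (at t within {0..})"
proof -
  have "(heat_approx G (Suc N) x y has_real_derivative
    (\<Sum>z\<in>neighbours G y. heat_approx G N x z t)
      - real (valence G y) * heat_approx G (Suc N) x y t) (at t within {0..})"
    if "0 \<le> t" for N t
    unfolding heat_approx_forward[OF fin sym that, symmetric] by (rule heat_approx_deriv[OF that])
  from min_heat_kernel_limit_deriv[OF this assms(2) fin] show ?thesis
    by (simp add: laplacian_eq fin)
qed

lemma min_heat_kernel_smooth: "smooth_half_line (min_heat_kernel G x y)"
proof -
  \<comment> \<open>The k-th time derivative is the k-th power of -Delta applied in the first
    variable; it is a finite combination of kernel entries, hence differentiable again.\<close>
  define D where
    "D k t = ((\<lambda>f z. - laplacian G f z) ^^ k) (\<lambda>z. min_heat_kernel G z y t)" for k t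
  have "((\<lambda>t. D k t z) has_real_derivative D (Suc k) t z) (at t within {0..})"
    if "0 \<le> t" for k t z
  proof (induction k arbitrary: z)
    case 0
    then show ?case using min_heat_kernel_backward[OF that] by (simp add: D_def)
  next
    case (Suc k)
    have *: "D (Suc k) t z = - (\<Sum>w\<in>neighbours G z. D k t z - D k t w)" for k t z
      by (simp add: D_def laplacian_def)
    have "((\<lambda>t. - (\<Sum>w\<in>neighbours G z. D k t z - D k t w)) has_real_derivative
        - (\<Sum>w\<in>neighbours G z. D (Suc k) t z - D (Suc k) t w)) (at t within {0..})"
      by (intro DERIV_minus DERIV_sum DERIV_diff Suc)
    then show ?case by (simp only: *)
  qed
  then show ?thesis
    unfolding smooth_half_line_def
    by (intro exI[of _ "\<lambda>k t. D k t x"]) (auto simp: D_def)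
qed

end

text \<open>Non-vertices have no neighbours, so finiteness extends to the whole type, on which the
  iterates are defined.\<close>

lemma finite_neighbours:
  assumes "simple_graph G" "locally_finite G"
  shows "finite (neighbours G x)"
proof (cases "x \<in> verts G")
  case False
  then have "neighbours G x = {}" using assms(1) by (auto simp: neighbours_def simple_graph_def)
  then show ?thesis by simp
qed (use assms in \<open>auto simp: locally_finite_def\<close>)

lemma neighbours_subset_verts: "simple_graph G \<Longrightarrow> neighbours G x \<subseteq> verts G"
  by (auto simp: neighbours_def simple_graph_def)

text \<open>For fixed \<open>y\<close> a heat solution is a non-negative supersolution in the first
  variable. In the limit this yields minimality.\<close>

lemma heat_approx_le_heat_solution:
  assumes G: "simple_graph G" "locally_finite G" and q: "heat_solution G q"
    and xy: "x \<in> verts G" "y \<in> verts G" and t: "0 \<le> t"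
  shows "heat_approx G N x y t \<le> q x y t"
proof -
  have "(\<Sum>y\<in>{y}. heat_approx G N x y t) \<le> q x y t"
    by (rule sum_heat_approx_le_supersolution[where V = "verts G" and b = t and S = "\<lambda>x. q x y"
          and S' = "\<lambda>x t. - laplacian G (\<lambda>z. q z y t) x"])
      (use q xy t finite_neighbours[OF G] neighbours_subset_verts[OF G(1)] in
        \<open>auto simp: heat_solution_def\<close>)
  then show ?thesis by simp
qed

lemma is_heat_kernel_min_heat_kernel:
  assumes G: "simple_graph G" "locally_finite G"
  shows "is_heat_kernel G (min_heat_kernel G)"
proof -
  note fin = finite_neighbours[OF G]
  have sym: "adj G x y \<longleftrightarrow> adj G y x" for x y using G(1) by (auto simp: simple_graph_def)
  have "heat_solution G (min_heat_kernel G)"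
    unfolding heat_solution_def
    using min_heat_kernel_smooth[OF fin] min_heat_kernel_zero[OF fin]
      min_heat_kernel_nonneg[OF fin] min_heat_kernel_backward[OF fin]
      min_heat_kernel_forward[OF fin sym]
    by blast
  moreover have "min_heat_kernel G x y t \<le> q x y t"
    if "heat_solution G q" "x \<in> verts G" "y \<in> verts G" "0 \<le> t" for q x y t
    by (rule LIMSEQ_le_const2[OF heat_approx_tendsto[OF fin that(4)]])
      (use heat_approx_le_heat_solution[OF G that] in auto)
  ultimately show ?thesis by (simp add: is_heat_kernel_def)
qed

section \<open>Stochastic incompleteness and bounded subsolutions\<close>

text \<open>
  The function \<open>1 + a M - a e\<^sup>t v\<close> is a supersolution with initial values at least \<open>1\<close>.  For small
  \<open>a > 0\<close> it stays non-negative beyond the time at which \<open>e\<^sup>t v(x\<^sub>0) = M\<close>, after which its value at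
  \<open>x\<^sub>0\<close> is less than \<open>1\<close>.
\<close>

lemma stochastically_incompleteI:
  fixes v :: "'a \<Rightarrow> real"
  assumes G: "simple_graph G" "locally_finite G" and x0: "x\<^sub>0 \<in> verts G" "0 < v x\<^sub>0"
    and v: "\<And>x. x \<in> verts G \<Longrightarrow> 0 \<le> v x" "\<And>x. x \<in> verts G \<Longrightarrow> v x \<le> M"
    and sub: "\<And>x. x \<in> verts G \<Longrightarrow> v x \<le> - laplacian G v x"
  shows "stochastically_incomplete G"
proof -
  note fin = finite_neighbours[OF G]
  have M: "0 < M" using x0 v(2)[of x\<^sub>0] by simp
  \<comment> \<open>As v(x0) <= M, the logarithm is non-negative; the added 1 makes \<open>b\<close>
    positive and exp b * v(x0) strictly larger than \<open>M\<close>.\<close>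
  define b where "b = ln (M / v x\<^sub>0) + 1"
  \<comment> \<open>This gives a e^t v <= 1 on [0, b], which keeps \<open>S\<close> non-negative
    there.\<close>
  define a where "a = 1 / (exp b * M)"
  define S where "S = (\<lambda>x t. 1 + a * M - a * exp t * v x)"
  have a: "0 < a" using M by (simp add: a_def)
  have "M / v x\<^sub>0 * 1 < M / v x\<^sub>0 * exp 1"
    using M x0 by (intro mult_strict_left_mono) auto
  then have "M / v x\<^sub>0 < exp b"
    using M x0 by (simp add: b_def exp_add)
  then have eb: "M < exp b * v x\<^sub>0" using x0 by (simp add: field_simps)
  have b: "0 < b"
    using x0 v(2)[of x\<^sub>0] by (simp add: b_def add_nonneg_pos)
  have S1: "S x\<^sub>0 b < 1"
    using mult_strict_left_mono[OF eb a] by (simp add: S_def mult.assoc)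
  have S_nonneg: "0 \<le> S x t" if x: "x \<in> verts G" and t: "0 \<le> t" "t \<le> b" for x t
  proof -
    have "a * (exp t * v x) \<le> a * (exp b * M)"
      using a v[OF x] t M by (intro mult_left_mono mult_mono) auto
    also have "\<dots> = 1" using M by (simp add: a_def)
    finally have "a * (exp t * v x) \<le> 1" .
    moreover have "0 < a * M" using a M by simp
    ultimately show ?thesis by (simp add: S_def mult.assoc)
  qed
  have le: "(\<Sum>y\<in>F. heat_approx G N x\<^sub>0 y b) \<le> S x\<^sub>0 b" if "finite F" for F N
  proof (rule sum_heat_approx_le_supersolution[where V = "verts G"
        and S' = "\<lambda>x t. - a * exp t * v x"])
    show "(S x has_real_derivative - a * exp t * v x) (at t within {0..})" for x t
      unfolding S_def by (auto intro!: derivative_eq_intros)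
    show "- laplacian G (\<lambda>z. S z t) x \<le> - a * exp t * v x" if "x \<in> verts G" for x t
    proof -
      have "laplacian G (\<lambda>z. S z t) x = a * exp t * (- laplacian G v x)"
        by (simp add: laplacian_def S_def sum_distrib_left sum_negf[symmetric] algebra_simps
            del: sum_negf)
      moreover have "a * exp t * v x \<le> a * exp t * (- laplacian G v x)"
        using a sub[OF that] by (intro mult_left_mono) auto
      ultimately show ?thesis by simp
    qed
    show "(if x \<in> F then 1 else 0) \<le> S x 0" if "x \<in> verts G" for x
    proof -
      have "S x 0 = 1 + a * M - a * v x" by (simp add: S_def)
      then have "1 \<le> S x 0" using mult_left_mono[OF v(2)[OF that], of a] a by linarith
      then show ?thesis by simp
    qed
  qed (use fin neighbours_subset_verts[OF G(1)] S_nonneg x0 b that in auto)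
  have le': "(\<Sum>y\<in>F. min_heat_kernel G x\<^sub>0 y b) \<le> S x\<^sub>0 b" if "finite F" for F
    by (rule LIMSEQ_le_const2[OF tendsto_sum[OF heat_approx_tendsto[OF fin]]])
      (use le[OF that] b in auto)
  have "(\<Sum>\<^sub>\<infinity>y\<in>verts G. ennreal (min_heat_kernel G x\<^sub>0 y b)) \<le> ennreal (S x\<^sub>0 b)"
  proof (rule infsum_le_finite_sums)
    show "(\<lambda>y. ennreal (min_heat_kernel G x\<^sub>0 y b)) summable_on verts G"
      by (rule nonneg_summable_on_complete) simp
    show "(\<Sum>y\<in>F. ennreal (min_heat_kernel G x\<^sub>0 y b)) \<le> ennreal (S x\<^sub>0 b)" if "finite F" for F
      using le'[OF that] min_heat_kernel_nonneg[OF fin, of b] b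
      by (subst sum_ennreal) (auto intro: ennreal_leI)
  qed
  also have "\<dots> < 1" using S1 by (simp add: ennreal_less_one_iff)
  finally show ?thesis
    unfolding stochastically_incomplete_def
    using is_heat_kernel_min_heat_kernel[OF G] x0 b by blast
qed

section \<open>Minimum principle and conservation of heat\<close>

text \<open>At a negative minimum of exp (-s) h over \<open>K\<close> and [0, t], h does not exceed
  its values at the neighbours, so Delta h <= 0 and h' >= 0. The weight exp (-s) turns this into a
  strictly positive derivative, so slightly earlier the weighted value was smaller still.\<close>

lemma heat_minimum_principle:
  fixes h :: "'a \<Rightarrow> real \<Rightarrow> real"
  assumes fin: "finite K"
    and deriv: "\<And>x t. x \<in> K \<Longrightarrow> 0 \<le> t \<Longrightarrow> (h x has_real_derivative h' x t) (at t within {0..})"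
    and super: "\<And>x t. x \<in> K \<Longrightarrow> 0 \<le> t \<Longrightarrow> - laplacian G (\<lambda>z. h z t) x \<le> h' x t"
    and init: "\<And>x. x \<in> K \<Longrightarrow> 0 \<le> h x 0"
    and outside: "\<And>x y t. x \<in> K \<Longrightarrow> y \<in> neighbours G x \<Longrightarrow> y \<notin> K \<Longrightarrow> 0 \<le> t \<Longrightarrow> 0 \<le> h y t"
    and x: "x \<in> K" and t: "0 \<le> t"
  shows "0 \<le> h x t"
proof (rule ccontr)
  assume neg: "\<not> 0 \<le> h x t"
  let ?f = "\<lambda>x s. exp (- s) * h x s"
  have cont: "continuous_on {0..t} (?f y)" if "y \<in> K" for y
    by (intro continuous_intros DERIV_continuous_on[OF has_field_derivative_subset[OF deriv]])
      (use that in auto)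
  have "\<exists>s\<in>{0..t}. \<forall>u\<in>{0..t}. ?f y s \<le> ?f y u" if "y \<in> K" for y
    by (rule continuous_attains_inf) (use cont[OF that] t in auto)
  \<comment> \<open>Minimise over time at each vertex, then over the finitely many vertices;
    together this is a minimum over space and time.\<close>
  then obtain \<tau> where \<tau>: "\<And>y. y \<in> K \<Longrightarrow> \<tau> y \<in> {0..t}"
    "\<And>y u. y \<in> K \<Longrightarrow> u \<in> {0..t} \<Longrightarrow> ?f y (\<tau> y) \<le> ?f y u"
    by metis
  define y where "y = arg_min_on (\<lambda>y. ?f y (\<tau> y)) K"
  have y: "y \<in> K" "\<And>z. z \<in> K \<Longrightarrow> ?f y (\<tau> y) \<le> ?f z (\<tau> z)"
    unfolding y_def using fin x by (auto intro!: arg_min_if_finite(1) arg_min_least)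
  define s where "s = \<tau> y"
  have min: "?f y s \<le> ?f z u" if "z \<in> K" "u \<in> {0..t}" for z u
    using y(2)[OF that(1)] \<tau>(2)[OF that] by (simp add: s_def)
  have s: "0 \<le> s" "s \<le> t" using \<tau>(1)[OF y(1)] by (auto simp: s_def)
  have "?f y s \<le> ?f x t" using x t by (intro min) auto
  also have "\<dots> < 0" using neg by (simp add: mult_pos_neg)
  finally have "?f y s < 0" .
  then have hneg: "h y s < 0" by (simp add: mult_less_0_iff)
  then have "s \<noteq> 0" using init[OF y(1)] by auto
  then have s0: "0 < s" using s by simp
  have "h y s \<le> h z s" if "z \<in> neighbours G y" for z
  proof (cases "z \<in> K")
    case True
    then show ?thesis using min[of z s] s by simp
  next
    case False
    then show ?thesis using outside[OF y(1) that _ s(1)] hneg by simp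
  qed
  then have "laplacian G (\<lambda>z. h z s) y \<le> 0"
    unfolding laplacian_def by (intro sum_nonpos) simp
  then have h': "0 \<le> h' y s" using super[OF y(1) s(1)] by simp
  have "(?f y has_real_derivative exp (- s) * (h' y s - h y s)) (at s within {0..})"
    by (auto intro!: derivative_eq_intros deriv y s simp: algebra_simps)
  moreover have "at s within {0..} = at s"
    using s0 by (intro at_within_interior) auto
  ultimately have D: "(?f y has_real_derivative exp (- s) * (h' y s - h y s)) (at s)" by simp
  moreover have "0 < exp (- s) * (h' y s - h y s)" using h' hneg by simp
  ultimately obtain d where d: "0 < d" "\<And>e. 0 < e \<Longrightarrow> e < d \<Longrightarrow> ?f y (s - e) < ?f y s"
    using DERIV_pos_inc_left[OF D] by blast
  \<comment> \<open>The half keeps the step below \<open>d\<close>; the bound \<open>s\<close> keeps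
    the earlier time non-negative.\<close>
  define e where "e = min (d / 2) s"
  have "?f y (s - e) < ?f y s" using d(1) s0 by (intro d(2)) (auto simp: e_def)
  moreover have "?f y s \<le> ?f y (s - e)"
    using s s0 d(1) by (intro min y) (auto simp: e_def)
  ultimately show False by simp
qed

text \<open>
  A supersolution tending to infinity forces conservation of heat: for the sum \<open>g\<close> of the heat kernel
  over a large finite set, \<open>g + \<epsilon> e\<^sup>t v\<close> stays above \<open>1\<close> by the minimum principle.
\<close>

lemma not_stochastically_incompleteI:
  fixes v :: "'a \<Rightarrow> real"
  assumes G: "simple_graph G" "locally_finite G"
    and v: "\<And>x. x \<in> verts G \<Longrightarrow> 0 \<le> v x"
    and exhausting: "\<And>C. finite {x \<in> verts G. v x < C}"
    and super: "\<And>x. x \<in> verts G \<Longrightarrow> - laplacian G v x \<le> v x"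
  shows "\<not> stochastically_incomplete G"
proof
  note closed = neighbours_subset_verts[OF G(1)]
  assume "stochastically_incomplete G"
  then obtain p x t where p: "heat_solution G p" and x: "x \<in> verts G" and t: "0 < t"
    and less: "(\<Sum>\<^sub>\<infinity>y\<in>verts G. ennreal (p x y t)) < 1"
    by (auto simp: stochastically_incomplete_def is_heat_kernel_def)
  obtain c where c: "(\<Sum>\<^sub>\<infinity>y\<in>verts G. ennreal (p x y t)) = ennreal c" "0 \<le> c" "c < 1"
    using less by (cases "\<Sum>\<^sub>\<infinity>y\<in>verts G. ennreal (p x y t)") (auto simp: ennreal_less_one_iff)
  have "1 - \<epsilon> \<le> c" if "0 < \<epsilon>" for \<epsilon>
  proof -
    \<comment> \<open>Chosen so that the correction \<eta> e^t v(x) is at most \<epsilon>; adding 1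
      to v(x) keeps the denominator positive.\<close>
    define \<eta> where "\<eta> = \<epsilon> / (exp t * (1 + v x))"
    have \<eta>: "0 < \<eta>" using that v[OF x] by (auto simp: \<eta>_def intro!: divide_pos_pos mult_pos_pos)
    \<comment> \<open>Outside \<open>K\<close> the term \<eta> v alone compensates the -1 in
      \<open>h\<close>; \<open>x\<close> is inserted because the minimum principle is evaluated
      there.\<close>
    define K where "K = insert x {x \<in> verts G. v x < 1 / \<eta>}"
    have K: "finite K" "K \<subseteq> verts G" using exhausting x by (auto simp: K_def)
    define h where "h = (\<lambda>x t. (\<Sum>y\<in>K. p x y t) + \<eta> * exp t * v x - 1)"
    have p_nonneg: "0 \<le> (\<Sum>y\<in>K. p x y t)" if "x \<in> verts G" "0 \<le> t" for x t
      using p K that by (intro sum_nonneg) (auto simp: heat_solution_def)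
    have "0 \<le> h x t"
    proof (rule heat_minimum_principle[where K = K and G = G and h = h and x = x and t = t and h' =
          "\<lambda>x t. (\<Sum>y\<in>K. - laplacian G (\<lambda>z. p z y t) x) + \<eta> * exp t * v x"])
      fix x t assume xt: "x \<in> K" "0 \<le> (t::real)"
      have "(p x y has_real_derivative - laplacian G (\<lambda>z. p z y t) x) (at t within {0..})"
        if "y \<in> K" for y
        using p K xt that by (auto simp: heat_solution_def)
      then show "(h x has_real_derivative
          (\<Sum>y\<in>K. - laplacian G (\<lambda>z. p z y t) x) + \<eta> * exp t * v x) (at t within {0..})"
        unfolding h_def by (auto intro!: derivative_eq_intros)
      have "laplacian G (\<lambda>z. h z t) x
          = (\<Sum>y\<in>K. laplacian G (\<lambda>z. p z y t) x) + \<eta> * exp t * laplacian G v x"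
        unfolding laplacian_def h_def sum.swap[of _ _ K]
        by (simp add: sum.distrib sum_subtractf sum_distrib_left algebra_simps)
      moreover have "\<eta> * exp t * (- laplacian G v x) \<le> \<eta> * exp t * v x"
        using super \<eta> xt K by (intro mult_left_mono) auto
      ultimately show "- laplacian G (\<lambda>z. h z t) x
          \<le> (\<Sum>y\<in>K. - laplacian G (\<lambda>z. p z y t) x) + \<eta> * exp t * v x"
        by (simp add: sum_negf)
    next
      fix x assume x: "x \<in> K"
      have "(\<Sum>y\<in>K. p x y 0) = (\<Sum>y\<in>K. if x = y then 1 else 0)"
      proof (rule sum.cong)
        fix y assume "y \<in> K"
        then have "x \<in> verts G" "y \<in> verts G" using x K by auto
        then show "p x y 0 = (if x = y then 1 else 0)"
          using p unfolding heat_solution_def by blast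
      qed simp
      then show "0 \<le> h x 0" using x K v \<eta> by (auto simp: h_def)
    next
      fix x y t assume y: "x \<in> K" "y \<in> neighbours G x" "y \<notin> K" and t: "0 \<le> (t::real)"
      then have yv: "y \<in> verts G" using closed by blast
      then have "1 \<le> \<eta> * v y" using y \<eta> by (auto simp: K_def field_simps)
      also have "\<dots> \<le> \<eta> * exp t * v y"
        using \<eta> v[OF yv] t by (intro mult_right_mono) auto
      finally show "0 \<le> h y t" using p_nonneg[OF yv t] by (simp add: h_def)
    qed (use K t in \<open>auto simp: K_def\<close>)
    moreover have "\<eta> * exp t * v x \<le> \<epsilon>"
    proof -
      have "\<eta> * exp t * v x = \<epsilon> * (v x / (1 + v x))" by (simp add: \<eta>_def)
      also have "\<dots> \<le> \<epsilon> * 1" using that v[OF x] by (intro mult_left_mono) auto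
      finally show ?thesis by simp
    qed
    ultimately have "1 - \<epsilon> \<le> (\<Sum>y\<in>K. p x y t)" by (simp add: h_def)
    moreover have "ennreal (\<Sum>y\<in>K. p x y t) \<le> (\<Sum>\<^sub>\<infinity>y\<in>verts G. ennreal (p x y t))"
    proof -
      have "ennreal (\<Sum>y\<in>K. p x y t) = (\<Sum>y\<in>K. ennreal (p x y t))"
        using p K x t by (subst sum_ennreal) (auto simp: heat_solution_def)
      also have "\<dots> \<le> (\<Sum>\<^sub>\<infinity>y\<in>verts G. ennreal (p x y t))"
        unfolding nonneg_infsum_complete[OF zero_le] by (rule SUP_upper) (use K in auto)
      finally show ?thesis .
    qed
    then have "(\<Sum>y\<in>K. p x y t) \<le> c"
      unfolding c using c(2) by (simp add: ennreal_le_iff)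
    ultimately show ?thesis by simp
  qed
  \<comment> \<open>Half of the missing mass 1 - c cannot bound all of it.\<close>
  from this[of "(1 - c) / 2"] c(3) show False by (simp add: field_simps)
qed

section \<open>Distance from the root\<close>

lemma graph_dist_le: "(adj G ^^ k) x y \<Longrightarrow> graph_dist G x y \<le> k"
  unfolding graph_dist_def by (rule Least_le)

lemma graph_dist_self [simp]: "graph_dist G x x = 0"
  using graph_dist_le[of 0 G x x] by simp

lemma admissible_adj:
  assumes "admissible_graph G" "adj G x y"
  shows "x \<in> verts G \<and> y \<in> verts G \<and> x \<noteq> y \<and> adj G y x"
  using assms unfolding admissible_graph_def simple_graph_def by blast

lemma admissible_finite_neighbours: "admissible_graph G \<Longrightarrow> finite (neighbours G x)"
  by (intro finite_neighbours) (auto simp: admissible_graph_def)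

context
  fixes G :: "'a ugraph" and x\<^sub>0 :: 'a
  assumes G: "admissible_graph G" and root: "x\<^sub>0 \<in> verts G"
begin

lemma graph_dist_walk: "x \<in> verts G \<Longrightarrow> (adj G ^^ graph_dist G x x\<^sub>0) x x\<^sub>0"
proof -
  assume "x \<in> verts G"
  then have "(adj G)\<^sup>*\<^sup>* x x\<^sub>0"
    using G root by (simp add: admissible_graph_def graph_connected_def)
  then obtain k where "(adj G ^^ k) x x\<^sub>0" by (auto simp: rtranclp_power)
  then show ?thesis unfolding graph_dist_def by (rule LeastI)
qed

lemma graph_dist_eq_0: "x \<in> verts G \<Longrightarrow> graph_dist G x x\<^sub>0 = 0 \<longleftrightarrow> x = x\<^sub>0"
  using graph_dist_walk[of x] by auto

lemma graph_dist_adj: "adj G x y \<Longrightarrow> graph_dist G x x\<^sub>0 \<le> Suc (graph_dist G y x\<^sub>0)"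
  using graph_dist_walk[of y] admissible_adj[OF G, of x y] by (blast intro: graph_dist_le relpowp_Suc_I2)

lemma graph_dist_parent:
  assumes x: "x \<in> verts G" and d: "graph_dist G x x\<^sub>0 = Suc r"
  obtains y where "adj G x y" "graph_dist G y x\<^sub>0 = r"
proof -
  from graph_dist_walk[OF x] obtain y where y: "adj G x y" "(adj G ^^ r) y x\<^sub>0"
    unfolding d by (meson relpowp_Suc_E2)
  have "graph_dist G y x\<^sub>0 = r"
    using graph_dist_le[OF y(2)] graph_dist_adj[OF y(1)] d by simp
  with y(1) show thesis by (rule that)
qed

text \<open>A vertex on the next sphere is a neighbour of the smaller ball, and neighbourhoods are
  finite.\<close>

lemma finite_ball: "finite {x \<in> verts G. graph_dist G x x\<^sub>0 \<le> r}"
proof (induction r)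
  case 0
  have "{x \<in> verts G. graph_dist G x x\<^sub>0 \<le> 0} \<subseteq> {x\<^sub>0}" using graph_dist_eq_0 by auto
  then show ?case by (rule finite_subset) simp
next
  case (Suc r)
  let ?B = "{x \<in> verts G. graph_dist G x x\<^sub>0 \<le> r}"
  have "{x \<in> verts G. graph_dist G x x\<^sub>0 \<le> Suc r} \<subseteq> ?B \<union> (\<Union>x\<in>?B. neighbours G x)"
  proof
    fix x assume x: "x \<in> {x \<in> verts G. graph_dist G x x\<^sub>0 \<le> Suc r}"
    show "x \<in> ?B \<union> (\<Union>x\<in>?B. neighbours G x)"
    proof (cases "graph_dist G x x\<^sub>0 = Suc r")
      case True
      then obtain y where "adj G x y" "graph_dist G y x\<^sub>0 = r"
        using x graph_dist_parent by blast
      then show ?thesis using admissible_adj[OF G, of x y] by (auto simp: neighbours_def)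
    qed (use x in auto)
  qed
  then show ?case
    by (rule finite_subset) (use Suc admissible_finite_neighbours[OF G] in auto)
qed

lemma finite_graph_sphere: "finite (graph_sphere G x\<^sub>0 r)"
  by (rule finite_subset[OF _ finite_ball[of r]]) (auto simp: graph_sphere_def)

text \<open>Following parents inward, an empty sphere would leave all farther spheres empty, and the
  infinite graph would be a finite ball.\<close>

lemma graph_sphere_nonempty: "graph_sphere G x\<^sub>0 r \<noteq> {}"
proof
  assume empty: "graph_sphere G x\<^sub>0 r = {}"
  have far: "graph_dist G x x\<^sub>0 \<noteq> r + k" if "x \<in> verts G" for x k
    using that
  proof (induction k arbitrary: x)
    case 0
    then show ?case using empty by (auto simp: graph_sphere_def)
  next
    case (Suc k)
    show ?case
    proof
      assume "graph_dist G x x\<^sub>0 = r + Suc k"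
      then obtain y where "adj G x y" "graph_dist G y x\<^sub>0 = r + k"
        using graph_dist_parent[OF Suc.prems, of "r + k"] by auto
      then show False using Suc.IH[of y] admissible_adj[OF G, of x y] by blast
    qed
  qed
  have "verts G \<subseteq> {x \<in> verts G. graph_dist G x x\<^sub>0 \<le> r}"
  proof
    fix x assume x: "x \<in> verts G"
    have "\<not> r \<le> graph_dist G x x\<^sub>0"
      using far[OF x, of "graph_dist G x x\<^sub>0 - r"] by auto
    then show "x \<in> {x \<in> verts G. graph_dist G x x\<^sub>0 \<le> r}" using x by simp
  qed
  then show False
    using finite_ball[of r] G finite_subset by (auto simp: admissible_graph_def)
qed

lemma valence_root_pos: "0 < valence G x\<^sub>0"
proof -
  obtain x where x: "x \<in> verts G" "graph_dist G x x\<^sub>0 = Suc 0"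
    using graph_sphere_nonempty[of "Suc 0"] by (auto simp: graph_sphere_def)
  then obtain y where y: "adj G x y" "graph_dist G y x\<^sub>0 = 0" by (rule graph_dist_parent)
  then have "x \<in> neighbours G x\<^sub>0"
    using graph_dist_eq_0[of y] admissible_adj[OF G, of x y] by (auto simp: neighbours_def)
  then show ?thesis using admissible_finite_neighbours[OF G] by (auto simp: valence_def card_gt_0_iff)
qed

text \<open>The parent of a vertex on the sphere of radius r + 2 has that vertex and its own parent
  as neighbours.\<close>

lemma exists_valence_ge_2: "\<exists>x\<in>graph_sphere G x\<^sub>0 (Suc r). 2 \<le> valence G x"
proof -
  obtain z where z: "z \<in> verts G" "graph_dist G z x\<^sub>0 = Suc (Suc r)"
    using graph_sphere_nonempty[of "Suc (Suc r)"] by (auto simp: graph_sphere_def)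
  then obtain x where x: "adj G z x" "graph_dist G x x\<^sub>0 = Suc r" by (rule graph_dist_parent)
  have xv: "x \<in> verts G" and xz: "adj G x z" using admissible_adj[OF G x(1)] by auto
  obtain y where y: "adj G x y" "graph_dist G y x\<^sub>0 = r" by (rule graph_dist_parent[OF xv x(2)])
  have "y \<noteq> z" using y z by auto
  then have "2 = card {y, z}" by simp
  also have "\<dots> \<le> valence G x"
    unfolding valence_def
    by (rule card_mono) (use y xz admissible_finite_neighbours[OF G] in \<open>auto simp: neighbours_def\<close>)
  finally show ?thesis using xv x by (auto simp: graph_sphere_def)
qed

end

section \<open>Uniqueness of the parent in a tree\<close>

text \<open>Loop erasure along the induction on the walk. Reachability of every entry is recorded so
  that a vertex into which no step leads can be excluded from the list.\<close>

lemma rtranclp_distinct_list: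
  assumes "R\<^sup>*\<^sup>* a b"
  obtains xs where "xs \<noteq> []" "hd xs = a" "last xs = b" "distinct xs" "successively R xs"
    "\<forall>w\<in>set xs. R\<^sup>*\<^sup>* a w"
proof -
  have "\<exists>xs. xs \<noteq> [] \<and> hd xs = a \<and> last xs = b \<and> distinct xs \<and> successively R xs
      \<and> (\<forall>w\<in>set xs. R\<^sup>*\<^sup>* a w)"
    using assms
  proof (induction rule: rtranclp_induct)
    case base
    show ?case by (rule exI[of _ "[a]"]) simp
  next
    case (step b c)
    then obtain xs where xs: "xs \<noteq> []" "hd xs = a" "last xs = b" "distinct xs"
      "successively R xs" "\<forall>w\<in>set xs. R\<^sup>*\<^sup>* a w"
      by blast
    show ?case
    proof (cases "c \<in> set xs")
      \<comment> \<open>The walk returns to an earlier entry: cut the list there, erasing the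
        loop.\<close>
      case True
      then obtain ys zs where eq: "xs = ys @ c # zs" by (meson split_list)
      show ?thesis
        by (rule exI[of _ "ys @ [c]"])
          (use xs in \<open>auto simp: eq successively_append_iff hd_append split: if_splits\<close>)
    next
      case False
      have "R\<^sup>*\<^sup>* a c" using step by (meson rtranclp.rtrancl_into_rtrancl)
      with False show ?thesis
        by (intro exI[of _ "xs @ [c]"]) (use xs step in \<open>auto simp: successively_append_iff\<close>)
    qed
  qed
  then show thesis using that by blast
qed

text \<open>
  Otherwise a neighbour \<open>y\<close> of \<open>x\<close> other than \<open>z\<close> could be joined to \<open>z\<close> through the root along
  shortest paths, which avoid \<open>x\<close>, and \<open>x\<close> would close a cycle.
\<close>

lemma tree_unique_parent:
  assumes T: "is_tree T" and root: "x\<^sub>0 \<in> verts T"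
    and y: "adj T x y" "graph_dist T y x\<^sub>0 \<le> graph_dist T x x\<^sub>0"
    and z: "adj T x z" "graph_dist T z x\<^sub>0 \<le> graph_dist T x x\<^sub>0"
  shows "y = z"
proof (rule ccontr)
  assume "y \<noteq> z"
  have G: "admissible_graph T" using T by (simp add: is_tree_def)
  note av = admissible_adj[OF G]
  \<comment> \<open>Adjacency in the tree with \<open>x\<close> deleted.\<close>
  define R where "R = (\<lambda>a b. adj T a b \<and> a \<noteq> x \<and> b \<noteq> x)"
  \<comment> \<open>Since \<open>k\<close> is at most the distance of \<open>x\<close>, each parent
    is strictly closer to the root than \<open>x\<close>, so the path never meets
    \<open>x\<close>.\<close>
  have to_root: "R\<^sup>*\<^sup>* w x\<^sub>0"
    if "graph_dist T w x\<^sub>0 = k" "w \<in> verts T" "w \<noteq> x" "k \<le> graph_dist T x x\<^sub>0" for w k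
    using that
  proof (induction k arbitrary: w)
    case 0
    then show ?case using graph_dist_eq_0[OF G root] by auto
  next
    case (Suc k)
    obtain u where u: "adj T w u" "graph_dist T u x\<^sub>0 = k"
      by (rule graph_dist_parent[OF G root Suc.prems(2,1)])
    have "R\<^sup>*\<^sup>* u x\<^sub>0" by (rule Suc.IH) (use u Suc.prems av[OF u(1)] in auto)
    moreover have "R w u" using u Suc.prems by (auto simp: R_def)
    ultimately show ?case by (rule converse_rtranclp_into_rtranclp[rotated])
  qed
  have "symp R" using av by (auto simp: symp_def R_def)
  then have "symp R\<^sup>*\<^sup>*" by (rule symp_rtranclp)
  moreover have "R\<^sup>*\<^sup>* y x\<^sub>0" "R\<^sup>*\<^sup>* z x\<^sub>0"
    using to_root[OF refl] y z av[OF y(1)] av[OF z(1)] by auto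
  ultimately have "R\<^sup>*\<^sup>* y z" by (meson rtranclp_trans sympD)
  then obtain xs where xs: "xs \<noteq> []" "hd xs = y" "last xs = z" "distinct xs" "successively R xs"
    "\<forall>w\<in>set xs. R\<^sup>*\<^sup>* y w"
    by (rule rtranclp_distinct_list)
  \<comment> \<open>No \<open>R\<close>-step ends in \<open>x\<close>, and the path starts at
    \<open>y\<close>, which differs from \<open>x\<close>.\<close>
  have "x \<notin> set xs"
  proof
    assume "x \<in> set xs"
    with xs(6) have "R\<^sup>*\<^sup>* y x" by blast
    then show False
      by (cases rule: rtranclp.cases) (use av[OF y(1)] in \<open>auto simp: R_def\<close>)
  qed
  \<comment> \<open>Together with \<open>x\<close> this gives the three vertices that a cycle
    needs.\<close>
  moreover have "2 \<le> length xs"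
    using xs(1-3) \<open>y \<noteq> z\<close> by (cases xs; cases "tl xs") auto
  moreover have "successively (adj T) xs"
    by (rule successively_mono[OF xs(5)]) (simp add: R_def)
  ultimately have "is_cycle T (x # xs)"
    using xs y z av[OF z(1)] by (auto simp: is_cycle_def successively_Cons)
  then show False using T by (auto simp: is_tree_def)
qed

section \<open>The radial solution on a model tree\<close>

text \<open>With one neighbour closer to the root and n(r) farther away, Delta v + v = 0 reads n(r)
  (v(r+1) - v(r)) = v(r) + (v(r) - v(r-1)), solved here for v(r+1). At the root the inward
  difference is absent.\<close>

fun radial :: "(nat \<Rightarrow> nat) \<Rightarrow> nat \<Rightarrow> real" where
  "radial n 0 = 1"
| "radial n (Suc 0) = 1 + 1 / real (n 0)"
| "radial n (Suc (Suc r)) = radial n (Suc r)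
     + (2 * radial n (Suc r) - radial n r) / real (n (Suc r))"

text \<open>Each increment is a non-negative number divided by a value of \<open>n\<close>; division
  by zero yields 0, which is harmless here.\<close>

lemma radial_mono_pos: "1 \<le> radial n r \<and> radial n r \<le> radial n (Suc r)"
  by (induction r) auto

lemma radial_mono: "r \<le> s \<Longrightarrow> radial n r \<le> radial n s"
  by (rule lift_Suc_mono_le[where f = "radial n"]) (use radial_mono_pos in blast)+

lemma radial_diff:
  assumes "0 < n 0"
  shows "real (n 0) * (radial n (Suc 0) - radial n 0) = radial n 0"
  using assms by simp

lemma radial_diff_Suc:
  assumes "0 < n (Suc r)"
  shows "real (n (Suc r)) * (radial n (Suc (Suc r)) - radial n (Suc r))
    = radial n (Suc r) + (radial n (Suc r) - radial n r)"
  using assms by simp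

lemma neg_laplacian: "- laplacian G f x = (\<Sum>y\<in>neighbours G x. f y - f x)"
  by (simp add: laplacian_def flip: sum_negf)

text \<open>A neighbour lies at distance at most r + 1, so it contributes at most \<delta>. Off the
  root one parent is split off, and exactly n(r) neighbours remain; the recursion then gives the
  bound.\<close>

lemma radial_supersolution:
  assumes G: "admissible_graph G" and root: "x\<^sub>0 \<in> verts G" and n: "branching_function G x\<^sub>0 n"
    and pos: "\<And>r. 0 < n r" and x: "x \<in> verts G"
  shows "- laplacian G (\<lambda>x. radial n (graph_dist G x x\<^sub>0)) x \<le> radial n (graph_dist G x x\<^sub>0)"
proof -
  let ?v = "\<lambda>x. radial n (graph_dist G x x\<^sub>0)" and ?N = "neighbours G x"
  define r where "r = graph_dist G x x\<^sub>0"
  define \<delta> where "\<delta> = radial n (Suc r) - radial n r"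
  note fin = admissible_finite_neighbours[OF G, of x]
  have le: "?v y - ?v x \<le> \<delta>" if "y \<in> ?N" for y
    using graph_dist_adj[OF G root, of y x] admissible_adj[OF G, of x y] that
    by (auto simp: \<delta>_def r_def neighbours_def intro: radial_mono)
  show ?thesis
  proof (cases r)
    case 0
    then have "x = x\<^sub>0" using graph_dist_eq_0[OF G root x] by (simp add: r_def)
    have "(\<Sum>y\<in>?N. ?v y - ?v x) \<le> real (valence G x) * \<delta>"
      using sum_bounded_above[of ?N, OF le] by (simp add: valence_def)
    also have "\<dots> = radial n r"
      using n radial_diff[of n, OF pos] 0 \<open>x = x\<^sub>0\<close>
      unfolding branching_function_def \<delta>_def by metis
    finally show ?thesis unfolding neg_laplacian by (simp add: r_def)
  next
    case (Suc q)
    obtain z where z: "adj G x z" "graph_dist G z x\<^sub>0 = q"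
      using graph_dist_parent[OF G root x] Suc unfolding r_def by blast
    then have zN: "z \<in> ?N" by (simp add: neighbours_def)
    have "x \<in> graph_sphere G x\<^sub>0 r" using x by (simp add: graph_sphere_def r_def)
    then have "int (n r) = int (valence G x) - 1"
      using n Suc by (auto simp: branching_function_def)
    then have card: "card (?N - {z}) = n r"
      using zN fin by (simp add: valence_def card_Diff_singleton)
    have "(\<Sum>y\<in>?N. ?v y - ?v x) = (?v z - ?v x) + (\<Sum>y\<in>?N - {z}. ?v y - ?v x)"
      by (rule sum.remove[OF fin zN])
    also have "\<dots> \<le> (?v z - ?v x) + real (n r) * \<delta>"
      using sum_bounded_above[of "?N - {z}" "\<lambda>y. ?v y - ?v x" \<delta>] le card by simp
    also have "\<dots> = ?v x"
      using radial_diff_Suc[of n q] pos[of "Suc q"] z Suc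
      by (simp add: \<delta>_def r_def[symmetric])
    finally show ?thesis unfolding neg_laplacian .
  qed
qed

text \<open>By \<open>tree_unique_parent\<close> all neighbours but one are farther from the root
  and contribute at least \<delta>. There are at least n(r) of them, and \<delta> >= 0 allows the
  surplus to be discarded.\<close>

lemma radial_subsolution:
  assumes T: "is_tree T" and root: "x\<^sub>0 \<in> verts T" and pos: "\<And>r. 0 < n r"
    and n0: "n 0 \<le> valence T x\<^sub>0"
    and n: "\<And>r x. x \<in> graph_sphere T x\<^sub>0 (Suc r) \<Longrightarrow> n (Suc r) + 1 \<le> valence T x"
    and x: "x \<in> verts T"
  shows "radial n (graph_dist T x x\<^sub>0) \<le> - laplacian T (\<lambda>x. radial n (graph_dist T x x\<^sub>0)) x"
proof -
  let ?v = "\<lambda>x. radial n (graph_dist T x x\<^sub>0)" and ?N = "neighbours T x"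
  define r where "r = graph_dist T x x\<^sub>0"
  define \<delta> where "\<delta> = radial n (Suc r) - radial n r"
  have \<delta>: "0 \<le> \<delta>" using radial_mono_pos by (simp add: \<delta>_def)
  have G: "admissible_graph T" using T by (simp add: is_tree_def)
  note fin = admissible_finite_neighbours[OF G, of x]
  show ?thesis
  proof (cases r)
    case 0
    then have "x = x\<^sub>0" using graph_dist_eq_0[OF G root x] by (simp add: r_def)
    have ge: "\<delta> \<le> ?v y - ?v x" if "y \<in> ?N" for y
    proof -
      have "adj T x y" using that by (simp add: neighbours_def)
      then have "graph_dist T y x\<^sub>0 \<noteq> 0"
        using graph_dist_eq_0[OF G root, of y] admissible_adj[OF G, of x y] \<open>x = x\<^sub>0\<close> by auto
      then show ?thesis
        using radial_mono[of "Suc 0" "graph_dist T y x\<^sub>0" n] 0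
        by (simp add: \<delta>_def r_def[symmetric] del: radial.simps)
    qed
    have "radial n r = real (n 0) * \<delta>"
      using radial_diff[of n, OF pos] 0 unfolding \<delta>_def by metis
    also have "\<dots> \<le> real (valence T x) * \<delta>"
      using n0 \<delta> \<open>x = x\<^sub>0\<close> by (intro mult_right_mono) auto
    also have "\<dots> \<le> (\<Sum>y\<in>?N. ?v y - ?v x)"
      using sum_bounded_below[of ?N, OF ge] by (simp add: valence_def)
    finally show ?thesis unfolding neg_laplacian by (simp add: r_def)
  next
    case (Suc q)
    obtain z where z: "adj T x z" "graph_dist T z x\<^sub>0 = q"
      using graph_dist_parent[OF G root x] Suc unfolding r_def by blast
    then have zN: "z \<in> ?N" by (simp add: neighbours_def)
    have "x \<in> graph_sphere T x\<^sub>0 (Suc q)" using x Suc by (simp add: graph_sphere_def r_def)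
    then have card: "n r \<le> card (?N - {z})"
      using n[of x q] zN fin Suc by (simp add: valence_def card_Diff_singleton)
    have ge: "\<delta> \<le> ?v y - ?v x" if "y \<in> ?N - {z}" for y
    proof -
      have "adj T x y" "y \<noteq> z" using that by (auto simp: neighbours_def)
      then have "\<not> graph_dist T y x\<^sub>0 \<le> graph_dist T x x\<^sub>0"
        using tree_unique_parent[OF T root, of x y z] z Suc by (auto simp: r_def)
      then show ?thesis
        using radial_mono[of "Suc r" "graph_dist T y x\<^sub>0" n]
        by (simp add: \<delta>_def r_def del: radial.simps)
    qed
    have "?v x = (?v z - ?v x) + real (n r) * \<delta>"
      using radial_diff_Suc[of n q, OF pos] z Suc by (simp add: \<delta>_def r_def[symmetric])
    also have "\<dots> \<le> (?v z - ?v x) + real (card (?N - {z})) * \<delta>"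
      using card \<delta> by (intro add_left_mono mult_right_mono) auto
    also have "\<dots> \<le> (?v z - ?v x) + (\<Sum>y\<in>?N - {z}. ?v y - ?v x)"
      using sum_bounded_below[of "?N - {z}" \<delta> "\<lambda>y. ?v y - ?v x"] ge by simp
    also have "\<dots> = (\<Sum>y\<in>?N. ?v y - ?v x)"
      by (rule sum.remove[OF fin zN, symmetric])
    finally show ?thesis unfolding neg_laplacian .
  qed
qed

text \<open>Every sphere off the root contains a vertex with both a parent and a child, and any
  vertex of the sphere determines the value of \<open>n\<close>.\<close>

lemma branching_function_pos:
  assumes G: "admissible_graph G" and root: "x\<^sub>0 \<in> verts G" and n: "branching_function G x\<^sub>0 n"
  shows "0 < n r"
proof (cases r)
  case 0
  then show ?thesis using valence_root_pos[OF G root] n by (simp add: branching_function_def)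
next
  case (Suc q)
  obtain x where x: "x \<in> graph_sphere G x\<^sub>0 (Suc q)" "2 \<le> valence G x"
    using exists_valence_ge_2[OF G root] by blast
  then have "int (n (Suc q)) = int (valence G x) - 1"
    using n unfolding branching_function_def by blast
  then show ?thesis using x(2) Suc by simp
qed

text \<open>If the increasing sequence were unbounded, its sublevel sets would lie in finite balls,
  and heat would be conserved.\<close>

lemma radial_bounded_of_stochastically_incomplete:
  assumes G: "admissible_graph G" and root: "x\<^sub>0 \<in> verts G" and n: "branching_function G x\<^sub>0 n"
    and inc: "stochastically_incomplete G"
  shows "\<exists>M. \<forall>r. radial n r \<le> M"
proof (rule ccontr)
  assume unbounded: "\<nexists>M. \<forall>r. radial n r \<le> M"
  have "\<not> stochastically_incomplete G"
  proof (rule not_stochastically_incompleteI)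
    show "simple_graph G" "locally_finite G" using G by (auto simp: admissible_graph_def)
    show "0 \<le> radial n (graph_dist G x x\<^sub>0)" for x
      using radial_mono_pos[of n "graph_dist G x x\<^sub>0"] by simp
    show "finite {x \<in> verts G. radial n (graph_dist G x x\<^sub>0) < C}" for C
    proof -
      obtain r where r: "C < radial n r" using unbounded by (meson not_le)
      have "{x \<in> verts G. radial n (graph_dist G x x\<^sub>0) < C}
          \<subseteq> {x \<in> verts G. graph_dist G x x\<^sub>0 \<le> r}"
      proof
        fix x assume x: "x \<in> {x \<in> verts G. radial n (graph_dist G x x\<^sub>0) < C}"
        then have "\<not> r \<le> graph_dist G x x\<^sub>0"
          using r radial_mono[of r "graph_dist G x x\<^sub>0" n] by auto
        then show "x \<in> {x \<in> verts G. graph_dist G x x\<^sub>0 \<le> r}" using x by auto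
      qed
      then show ?thesis by (rule finite_subset) (rule finite_ball[OF G root])
    qed
    show "- laplacian G (\<lambda>x. radial n (graph_dist G x x\<^sub>0)) x \<le> radial n (graph_dist G x x\<^sub>0)"
      if "x \<in> verts G" for x
      by (rule radial_supersolution[OF G root n branching_function_pos[OF G root n] that])
  qed
  with inc show False by blast
qed

theorem theorem3p3p2:
  fixes T T\<^sub>n :: "'a ugraph" and x\<^sub>0 :: 'a and n :: "nat \<Rightarrow> nat"
  assumes "is_tree T"
    and "x\<^sub>0 \<in> verts T"
    and "subgraph T\<^sub>n T"
    and "model_tree T\<^sub>n x\<^sub>0"
    and "branching_function T\<^sub>n x\<^sub>0 n"
    and "\<forall>r>0. int (n r) \<le> int (min_valence T x\<^sub>0 r) - 1"
    and "stochastically_incomplete T\<^sub>n"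
  shows "stochastically_incomplete T"
proof -
  have G: "admissible_graph T" using assms(1) by (simp add: is_tree_def)
  have Gn: "admissible_graph T\<^sub>n" and rootn: "x\<^sub>0 \<in> verts T\<^sub>n"
    using assms(4) by (auto simp: model_tree_def is_tree_def)
  note pos = branching_function_pos[OF Gn rootn assms(5)]
  obtain M where M: "\<And>r. radial n r \<le> M"
    using radial_bounded_of_stochastically_incomplete[OF Gn rootn assms(5,7)] by blast
  \<comment> \<open>The valence hypothesis covers only r > 0; at the root the inequality comes from
    the inclusion of the trees.\<close>
  have "neighbours T\<^sub>n x\<^sub>0 \<subseteq> neighbours T x\<^sub>0"
    using assms(3) by (auto simp: subgraph_def neighbours_def)
  then have n0: "n 0 \<le> valence T x\<^sub>0"
    using assms(5) admissible_finite_neighbours[OF G, of x\<^sub>0]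
    by (auto simp: branching_function_def valence_def intro: card_mono)
  have n: "n (Suc r) + 1 \<le> valence T x" if "x \<in> graph_sphere T x\<^sub>0 (Suc r)" for r x
  proof -
    have "min_valence T x\<^sub>0 (Suc r) \<le> valence T x"
      unfolding min_valence_def
      using finite_graph_sphere[OF G assms(2)] that by (intro Min_le) auto
    moreover have "int (n (Suc r)) \<le> int (min_valence T x\<^sub>0 (Suc r)) - 1"
      using assms(6) by blast
    ultimately show ?thesis by linarith
  qed
  \<comment> \<open>Distances are now measured in \<open>T\<close>; only the sequence
    \<open>radial n\<close> and its bound are carried over from the model tree.\<close>
  show ?thesis
  proof (rule stochastically_incompleteI[where v = "\<lambda>x. radial n (graph_dist T x x\<^sub>0)"])
    show "simple_graph T" "locally_finite T" using G by (auto simp: admissible_graph_def)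
    show "0 \<le> radial n (graph_dist T x x\<^sub>0)" for x
      using radial_mono_pos[of n "graph_dist T x x\<^sub>0"] by simp
    show "radial n (graph_dist T x x\<^sub>0) \<le> - laplacian T (\<lambda>x. radial n (graph_dist T x x\<^sub>0)) x"
      if "x \<in> verts T" for x
      by (rule radial_subsolution[OF assms(1,2) pos n0 n that])
  qed (use assms(2) M in auto)
qed

end
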